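(* For all positive integers $k$ and nonnegative integers $n$, $$\mathrm{OOT}(\delta_{n+2k}/\delta_n)=\prod_{i=1}^{k}\frac{(2(n+i+k-1))!}{(2i-1)!}\;\det\left[\hat G_{2(n+i+j-1)}\right]_{i,j=1}^{k},$$ where $\hat G_{2m}=G_{2m}/(2m)!$. In particular, for the zigzag $\delta_{n+2}/\delta_n$ one has $\mathrm{OOT}(\delta_{n+2}/\delta_n)=G_{2n+2}$.
   Context: $\delta_n=(n-1,n-2,\dots,1)$ is the staircase partition, with $\delta_0=\delta_1=\varnothing$. $G_{2m}$ is the unsigned Genocchi number $G_{2m}=2(-1)^{m-1}(4^m-1)B_{2m}$, with $B_{2m}$ the Bernoulli number (so $G_2=G_4=1$, $G_6=3$, $G_8=17$). For partitions $[\mu]\subseteq[\lambda]$, with $\lambda$ having $d$ (positive) parts, $\mathrm{OOT}(\lambda/\mu)$ is the number of semistandard Young tableaux $T$ of shape $\mu$ with entries in $\{1,\dots,d\}$ such that $\prod_{u\in[\mu]}(\lambda_{d+1-T(u)}-c(u))\ne 0$, where $c(i,j)=j-i$ is the content; this is the number of nonzero terms in the Okounkov--Olshanski formula $f^{\lambda/\mu}=\frac{|\lambda/\mu|!}{\prod_{u\in[\lambda]}h(u)}\sum_{T}\prod_{u\in[\mu]}(\lambda_{d+1-T(u)}-c(u))$, where $T$ runs over all semistandard Young tableaux of shape $\mu$ with entries at most $d$, $f^{\lambda/\mu}$ is the number of standard Young tableaux of shape $\lambda/\mu$, and $h(u)$ is the hook length of $u$ in $\lambda$. *)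

theory Defs
  imports
    Complex_Main
    "HOL-Library.FuncSet"
    "HOL-Computational_Algebra.Formal_Power_Series"
    "Jordan_Normal_Form.Determinant"
begin

section \<open>Partitions and semistandard tableaux\<close>

text \<open>A partition is the list of its positive parts, so its number of parts is the length
  of the list.\<close>

definition is_partition :: "nat list \<Rightarrow> bool" where
  "is_partition la \<longleftrightarrow> sorted_wrt (\<ge>) la \<and> (\<forall>p \<in> set la. 0 < p)"

text \<open>Parts are indexed from 1, and are 0 beyond the last positive part.\<close>

definition part :: "nat list \<Rightarrow> nat \<Rightarrow> nat" where
  "part la i = (if 1 \<le> i \<and> i \<le> length la then la ! (i - 1) else 0)"

definition diagram :: "nat list \<Rightarrow> (nat \<times> nat) set" where
  "diagram la = {(i, j). 1 \<le> i \<and> 1 \<le> j \<and> j \<le> part la i}"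

definition cell_content :: "nat \<times> nat \<Rightarrow> int" where
  "cell_content u = int (snd u) - int (fst u)"

text \<open>Semistandard Young tableaux of shape \<open>mu\<close> with entries in \<open>{1..d}\<close>.  A tableau is a
  function on the diagram; using extensional functions makes distinct elements of this set
  distinct fillings.\<close>

definition ssyt :: "nat list \<Rightarrow> nat \<Rightarrow> (nat \<times> nat \<Rightarrow> nat) set" where
  "ssyt mu d = {T \<in> diagram mu \<rightarrow>\<^sub>E {1..d}.
     (\<forall>i j j'. (i, j) \<in> diagram mu \<longrightarrow> (i, j') \<in> diagram mu \<longrightarrow> j < j' \<longrightarrow> T (i, j) \<le> T (i, j')) \<and>
     (\<forall>i i' j. (i, j) \<in> diagram mu \<longrightarrow> (i', j) \<in> diagram mu \<longrightarrow> i < i' \<longrightarrow> T (i, j) < T (i', j))}"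

text \<open>The product attached to a tableau in the Okounkov--Olshanski formula is an integer
  product; its factors may be negative or zero.\<close>

definition oo_term :: "nat list \<Rightarrow> nat list \<Rightarrow> (nat \<times> nat \<Rightarrow> nat) \<Rightarrow> int" where
  "oo_term la mu T =
     (\<Prod>u \<in> diagram mu. int (part la (length la + 1 - T u)) - cell_content u)"

text \<open>Meaningful for partitions with \<open>diagram mu \<subseteq> diagram la\<close>.\<close>

definition OOT :: "nat list \<Rightarrow> nat list \<Rightarrow> nat" where
  "OOT la mu = card {T \<in> ssyt mu (length la). oo_term la mu T \<noteq> 0}"

definition staircase :: "nat \<Rightarrow> nat list" where
  "staircase n = rev [1..<n]"

lemma length_staircase: "length (staircase n) = n - 1"
  by (simp add: staircase_def)

lemma part_staircase: "part (staircase n) i = (if 1 \<le> i then n - i else 0)"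
  by (auto simp: part_def staircase_def rev_nth)

lemma is_partition_staircase: "is_partition (staircase n)"
  by (auto simp: is_partition_def staircase_def sorted_wrt_rev)

lemma diagram_staircase_mono: "m \<le> n \<Longrightarrow> diagram (staircase m) \<subseteq> diagram (staircase n)"
  by (auto simp: diagram_def part_staircase)

lemma finite_diagram: "finite (diagram la)"
proof -
  have "diagram la \<subseteq> (\<Union>i \<in> {1..length la}. {i} \<times> {1..part la i})"
    by (auto simp: diagram_def part_def split: if_splits)
  then show ?thesis
    by (rule finite_subset) auto
qed

lemma finite_ssyt: "finite (ssyt mu d)"
proof (rule finite_subset)
  show "ssyt mu d \<subseteq> diagram mu \<rightarrow>\<^sub>E {1..d}"
    by (auto simp: ssyt_def)
  show "finite (diagram mu \<rightarrow>\<^sub>E {1..d})"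
    by (intro finite_PiE finite_diagram) auto
qed

section \<open>Bernoulli and Genocchi numbers\<close>

text \<open>The exponential generating function is $x / (e^x - 1)$, hence $B_1 = -1/2$.\<close>

definition bernoulli :: "nat \<Rightarrow> real" where
  "bernoulli n = fact n * fps_nth (fps_X / (fps_exp 1 - 1)) n"

lemma bernoulli_egf:
  "Abs_fps (\<lambda>n. bernoulli n / fact n) * (fps_exp 1 - 1) = fps_X"
proof -
  have "fps_nth (fps_exp (1 :: real) - 1) 1 \<noteq> 0"
    by simp
  then have nz: "fps_exp (1 :: real) - 1 \<noteq> 0"
    by (metis fps_zero_nth)
  have "subdegree (fps_exp (1 :: real) - 1) = 1"
    by (rule subdegreeI) auto
  then have dvd: "fps_exp (1 :: real) - 1 dvd fps_X"
    using nz by (simp add: fps_dvd_iff)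
  have "Abs_fps (\<lambda>n. bernoulli n / fact n) = fps_X / (fps_exp 1 - 1)"
    by (rule fps_ext) (simp add: bernoulli_def)
  with dvd show ?thesis
    by simp
qed

text \<open>\<open>genocchi_even m\<close> is the unsigned Genocchi number \<open>G\<^sub>2\<^sub>m\<close> (for \<open>m \<ge> 1\<close>), and
  \<open>genocchi_hat m\<close> is \<open>G\<^sub>2\<^sub>m / (2m)!\<close>: the argument is half the usual index.\<close>

definition genocchi_even :: "nat \<Rightarrow> real" where
  "genocchi_even m = 2 * (-1) ^ (m - 1) * (4 ^ m - 1) * bernoulli (2 * m)"

definition genocchi_hat :: "nat \<Rightarrow> real" where
  "genocchi_hat m = genocchi_even m / fact (2 * m)"

text \<open>The \<open>k \<times> k\<close> matrix with \<open>(i, j)\<close> entry \<open>genocchi_hat (n + i + j - 1)\<close>, \<open>1 \<le> i, j \<le> k\<close>;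
  the library's matrix indices start at 0.\<close>

definition genocchi_matrix :: "nat \<Rightarrow> nat \<Rightarrow> real mat" where
  "genocchi_matrix n k = mat k k (\<lambda>(i, j). genocchi_hat (n + (i + 1) + (j + 1) - 1))"

end

theory Submission
  imports Defs
begin

text \<open>
  The idea is to count the tableaux by one determinant whose rows are Fibonacci polynomials, and to
  recognise the coefficients of these polynomials, in a suitable basis, as coefficients of
  $\cosh(x/2)$ and $\sinh(x/2)$. Eliminating the hyperbolic cosine leaves a small determinant in the
  coefficients of $\tanh(x/2)$, which are Genocchi numbers up to sign.

  For a staircase $\lambda$ the $(d+1-t)$-th part is $t$. A tableau therefore contributes iff no entry
  equals the content of its cell, and for a semistandard tableau this says that the first row
  satisfies $T(1,j) \ge j$ (\<open>OOT_staircase\<close>).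

  Tableaux of any shape $\nu$ with this flag condition and entries at most $t$ are counted by the
  $t \times t$ determinant with entries ${b_i - r \choose r}$, $b_i = t + i - \nu_i$, indices starting at 0
  (\<open>card_flagged_tableaux\<close>). The proof is an induction that removes the largest entry: the
  remaining shapes interlace $\nu$, and the sum over them is what subtracting consecutive rows of the
  determinant produces, since the rows $Q_b(z) = \sum_r {b-r \choose r} z^r$ satisfy
  $Q_{b+1} - Q_b = z Q_{b-1}$.

  Binet's formula suggests the variable $s = z + 1/4$, in which the coefficients of $Q_b$ become
  $2^{2l-b} {b+1 \choose 2l+1}$, that is, up to factorials depending on the row or on the column alone,
  the coefficients of $x^{b-2l}$ in $e^{x/2}$ (\<open>row_det_fib_binom\<close>). For the staircase the
  indices $b$ consist of $n+k-1$ even and $k$ odd numbers. The even rows belong to the unitriangular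
  Toeplitz matrix of $\cosh(x/2)$, the odd ones are made of coefficients of $\sinh(x/2)$; dividing by the
  Toeplitz matrix leaves a $k \times k$ Hankel determinant of coefficients of $\tanh(x/2)$
  (\<open>row_det_half_exp\<close>). Finally $x\tanh(x/2) = 2\beta(2x) - 2\beta(x) + x$ with
  $\beta(x) = x/(e^x-1)$ expresses these through Bernoulli numbers (\<open>tanh_half_cosh_half\<close>).
\<close>

section \<open>Determinants\<close>

lemma det_leibniz:
  fixes a :: "nat \<Rightarrow> nat \<Rightarrow> 'a :: comm_ring_1"
  shows "det (mat n n (\<lambda>(i, j). a i j)) =
    (\<Sum>p | p permutes {0..<n}. signof p * (\<Prod>i<n. a i (p i)))"
proof -
  have "det (mat n n (\<lambda>(i, j). a i j)) = (\<Sum>p | p permutes {0..<n}. signof p *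
      (\<Prod>i = 0..<n. mat n n (\<lambda>(i, j). a i j) $$ (i, p i)))"
    by (rule det_def') simp
  also have "\<dots> = (\<Sum>p | p permutes {0..<n}. signof p * (\<Prod>i<n. a i (p i)))"
  proof (intro sum.cong refl arg_cong[of _ _ "(*) _"] prod.cong)
    fix p i
    assume "p \<in> {p. p permutes {0..<n}}" "i \<in> {..<n}"
    then have "p i < n" "i < n"
      using permutes_in_image[of p "{0..<n}" i] by auto
    then show "mat n n (\<lambda>(i, j). a i j) $$ (i, p i) = a i (p i)"
      by simp
  qed auto
  finally show ?thesis .
qed

lemma det_scale_rows_cols:
  fixes a :: "nat \<Rightarrow> nat \<Rightarrow> 'a :: comm_ring_1"
  shows "det (mat n n (\<lambda>(i, j). r i * c j * a i j)) =
    (\<Prod>i<n. r i) * (\<Prod>j<n. c j) * det (mat n n (\<lambda>(i, j). a i j))"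
proof -
  have "(\<Prod>i<n. r i * c (p i) * a i (p i)) =
      (\<Prod>i<n. r i) * (\<Prod>j<n. c j) * (\<Prod>i<n. a i (p i))" if "p permutes {0..<n}" for p
  proof -
    have "(\<Prod>i<n. c (p i)) = (\<Prod>j<n. c j)"
      using prod.permute[OF that, of c] by (simp add: lessThan_atLeast0)
    then show ?thesis
      by (simp add: prod.distrib)
  qed
  then show ?thesis
    unfolding det_leibniz sum_distrib_left
    by (intro sum.cong) (auto simp: mult_ac)
qed

text \<open>The same permutation acts on rows and columns, so its sign occurs squared.\<close>

lemma det_reverse_rows_cols:
  fixes a :: "nat \<Rightarrow> nat \<Rightarrow> 'a :: comm_ring_1"
  shows "det (mat n n (\<lambda>(i, j). a (n - 1 - i) (n - 1 - j))) = det (mat n n (\<lambda>(i, j). a i j))"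
proof -
  define p where "p i = (if i < n then n - 1 - i else i)" for i
  have p: "p permutes {0..<n}"
  proof (rule bij_imp_permutes)
    show "bij_betw p {0..<n} {0..<n}"
      by (rule bij_betw_byWitness[where f' = p]) (auto simp: p_def)
  qed (auto simp: p_def)
  have rows: "det (mat n n (\<lambda>(i, j). f (p i) j)) = signof p * det (mat n n (\<lambda>(i, j). f i j))"
    for f :: "nat \<Rightarrow> nat \<Rightarrow> 'a"
  proof -
    have "mat n n (\<lambda>(i, j). f (p i) j) = mat n n (\<lambda>(i, j). mat n n (\<lambda>(i, j). f i j) $$ (p i, j))"
      using p by (intro eq_matI) (auto simp: p_def)
    then show ?thesis
      using det_permute_rows[OF _ p, of "mat n n (\<lambda>(i, j). f i j)"] by simp
  qed
  have tr: "det (mat n n (\<lambda>(i, j). f i j)) = det (mat n n (\<lambda>(i, j). f j i))"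
    for f :: "nat \<Rightarrow> nat \<Rightarrow> 'a"
  proof -
    have "transpose_mat (mat n n (\<lambda>(i, j). f i j)) = mat n n (\<lambda>(i, j). f j i)"
      by (intro eq_matI) auto
    then show ?thesis
      using det_transpose[of "mat n n (\<lambda>(i, j). f i j)" n] by simp
  qed
  have "det (mat n n (\<lambda>(i, j). a (n - 1 - i) (n - 1 - j))) = det (mat n n (\<lambda>(i, j). a (p i) (p j)))"
    by (intro arg_cong[of _ _ det] eq_matI) (auto simp: p_def)
  also have "\<dots> = signof p * det (mat n n (\<lambda>(i, j). a i (p j)))"
    by (rule rows)
  also have "det (mat n n (\<lambda>(i, j). a i (p j))) = det (mat n n (\<lambda>(i, j). a j (p i)))"
    by (rule tr)
  also have "\<dots> = signof p * det (mat n n (\<lambda>(i, j). a j i))"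
    by (rule rows)
  also have "det (mat n n (\<lambda>(i, j). a j i)) = det (mat n n (\<lambda>(i, j). a i j))"
    by (rule tr)
  also have "signof p * (signof p * det (mat n n (\<lambda>(i, j). a i j))) = det (mat n n (\<lambda>(i, j). a i j))"
    by (simp add: sign_def)
  finally show ?thesis .
qed

text \<open>Multilinearity in all rows at once, with a different summation range for each row.\<close>

lemma det_sum_rows:
  fixes f :: "nat \<Rightarrow> 'b \<Rightarrow> nat \<Rightarrow> 'a :: comm_ring_1"
  assumes "\<And>i. i < n \<Longrightarrow> finite (S i)"
  shows "det (mat n n (\<lambda>(i, j). \<Sum>c\<in>S i. f i c j)) =
    (\<Sum>c\<in>PiE {..<n} S. det (mat n n (\<lambda>(i, j). f i (c i) j)))"
proof -
  have "(\<Prod>i<n. \<Sum>c\<in>S i. f i c (p i)) = (\<Sum>c\<in>PiE {..<n} S. \<Prod>i<n. f i (c i) (p i))" for p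
    using assms by (intro prod_sum_PiE) auto
  then show ?thesis
    unfolding det_leibniz by (simp add: sum_distrib_left sum.swap[of _ "PiE {..<n} S"])
qed

lemma det_unit_lower_triangular:
  fixes a :: "nat \<Rightarrow> nat \<Rightarrow> 'a :: comm_ring_1"
  assumes "\<And>i j. i < j \<Longrightarrow> j < n \<Longrightarrow> a i j = 0" "\<And>i. i < n \<Longrightarrow> a i i = 1"
  shows "det (mat n n (\<lambda>(i, j). a i j)) = 1"
proof -
  have "det (mat n n (\<lambda>(i, j). a i j)) = prod_list (diag_mat (mat n n (\<lambda>(i, j). a i j)))"
    using assms by (intro det_lower_triangular[where n = n]) auto
  also have "diag_mat (mat n n (\<lambda>(i, j). a i j)) = map (\<lambda>_. 1) [0..<n]"
    using assms by (auto simp: diag_mat_def)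
  also have "prod_list (map (\<lambda>_. 1 :: 'a) [0..<n]) = 1"
    by (induction n) auto
  finally show ?thesis .
qed

lemma det_mult_mat:
  fixes a b :: "nat \<Rightarrow> nat \<Rightarrow> 'a :: comm_ring_1"
  shows "det (mat n n (\<lambda>(i, j). \<Sum>r<n. a i r * b r j)) =
    det (mat n n (\<lambda>(i, j). a i j)) * det (mat n n (\<lambda>(i, j). b i j))"
proof -
  have "mat n n (\<lambda>(i, j). \<Sum>r<n. a i r * b r j) =
      mat n n (\<lambda>(i, j). a i j) * mat n n (\<lambda>(i, j). b i j)"
    by (intro eq_matI) (auto simp: scalar_prod_def lessThan_atLeast0)
  then show ?thesis
    by (simp add: det_mult[of _ n])
qed

text \<open>The first column consists of ones, so subtracting from each row its predecessor turns it into a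
  unit vector. This is the determinant side of removing the largest entry from a tableau.\<close>

lemma det_row_differences:
  fixes f :: "nat \<Rightarrow> nat \<Rightarrow> 'a :: idom"
  assumes "\<And>i. i \<le> t \<Longrightarrow> f i 0 = 1"
  shows "det (mat (Suc t) (Suc t) (\<lambda>(i, r). f i r)) =
    det (mat t t (\<lambda>(i, r). f (Suc i) (Suc r) - f i (Suc r)))"
proof -
  define L :: "nat \<Rightarrow> nat \<Rightarrow> 'a" where
    "L i j = (if i = j then 1 else if i = Suc j then -1 else 0)" for i j
  define D where "D = mat t t (\<lambda>(i, r). f (Suc i) (Suc r) - f i (Suc r))"
  have "det (mat (Suc t) (Suc t) (\<lambda>(i, r). \<Sum>s<Suc t. L i s * f s r)) =
      det (mat (Suc t) (Suc t) (\<lambda>(i, r). f i r))"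
    unfolding det_mult_mat by (subst det_unit_lower_triangular) (auto simp: L_def)
  moreover have "mat (Suc t) (Suc t) (\<lambda>(i, r). \<Sum>s<Suc t. L i s * f s r) =
      four_block_mat (mat 1 1 (\<lambda>_. 1)) (mat 1 t (\<lambda>(i, r). f 0 (Suc r))) (0\<^sub>m t 1) D"
  proof (rule eq_matI)
    fix i r
    assume "i < dim_row (four_block_mat (mat 1 1 (\<lambda>_. 1)) (mat 1 t (\<lambda>(i, r). f 0 (Suc r))) (0\<^sub>m t 1) D)"
      and "r < dim_col (four_block_mat (mat 1 1 (\<lambda>_. 1)) (mat 1 t (\<lambda>(i, r). f 0 (Suc r))) (0\<^sub>m t 1) D)"
    then have ir: "i < Suc t" "r < Suc t"
      by (auto simp: D_def)
    have "(\<Sum>s<Suc t. L i s * f s r) = (if i = 0 then f 0 r else f i r - f (i - 1) r)"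
    proof (cases i)
      case 0
      have "(\<Sum>s<Suc t. L i s * f s r) = (\<Sum>s\<in>{0}. L i s * f s r)"
        using 0 by (intro sum.mono_neutral_right) (auto simp: L_def)
      then show ?thesis
        using 0 by (simp add: L_def)
    next
      case (Suc i')
      have "(\<Sum>s<Suc t. L i s * f s r) = (\<Sum>s\<in>{i', i}. L i s * f s r)"
        using Suc ir by (intro sum.mono_neutral_right) (auto simp: L_def)
      then show ?thesis
        using Suc by (simp add: L_def)
    qed
    then show "mat (Suc t) (Suc t) (\<lambda>(i, r). \<Sum>s<Suc t. L i s * f s r) $$ (i, r) =
        four_block_mat (mat 1 1 (\<lambda>_. 1)) (mat 1 t (\<lambda>(i, r). f 0 (Suc r))) (0\<^sub>m t 1) D $$ (i, r)"
      using ir assms[of i] assms[of "i - 1"] by (auto simp: D_def)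
  qed (auto simp: D_def)
  moreover have "det (four_block_mat (mat 1 1 (\<lambda>_. 1)) (mat 1 t (\<lambda>(i, r). f 0 (Suc r))) (0\<^sub>m t 1) D) = det D"
    by (subst det_four_block_mat_lower_left_zero_col[where n = t]) (auto simp: D_def det_single)
  ultimately show ?thesis
    by (simp add: D_def)
qed

text \<open>The rows of the matrices below are indexed by numbers that have to be sorted by parity.
  Keeping the indices in a list makes the sign of this reordering computable by moving one list
  element at a time.\<close>

definition row_det :: "('b \<Rightarrow> nat \<Rightarrow> 'a :: comm_ring_1) \<Rightarrow> 'b list \<Rightarrow> 'a" where
  "row_det f xs = det (mat (length xs) (length xs) (\<lambda>(i, j). f (xs ! i) j))"

lemma row_det_move_to_front:
  "row_det f (xs @ x # ys) = (-1) ^ length xs * row_det f (x # xs @ ys)"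
proof -
  let ?n = "Suc (length xs + length ys)"
  let ?A = "mat ?n ?n (\<lambda>(i, j). f ((xs @ x # ys) ! i) j)"
  have "swap_row_to_front ?A (length xs) = mat ?n ?n (\<lambda>(i, j). f ((x # xs @ ys) ! i) j)"
    by (subst swap_row_to_front_result[of _ ?n ?n])
      (auto intro!: eq_matI simp: nth_append nth_Cons Suc_diff_le split: nat.splits)
  then have "row_det f (x # xs @ ys) = (-1) ^ length xs * row_det f (xs @ x # ys)"
    using swap_row_to_front_det[of ?A ?n "length xs"] by (simp add: row_det_def)
  then show ?thesis
    by (simp flip: mult.assoc power_mult_distrib)
qed

section \<open>Fibonacci polynomials\<close>

text \<open>For fixed \<open>b\<close> these are the coefficients of the Fibonacci polynomial
  $Q_b(z) = \sum_r {b-r \choose r} z^r$, and $Q_{b+1} = Q_b + z Q_{b-1}$ is the recurrence that drives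
  everything below. Truncated subtraction gives the correct value \<open>0\<close> for \<open>0 < r\<close>, \<open>b < r\<close>.\<close>

definition fib_binom :: "nat \<Rightarrow> nat \<Rightarrow> real" where
  "fib_binom b r = real ((b - r) choose r)"

lemma fib_binom_0 [simp]: "fib_binom b 0 = 1"
  by (simp add: fib_binom_def)

lemma fib_binom_recurrence:
  assumes "1 \<le> b"
  shows "fib_binom (Suc b) (Suc r) = fib_binom b (Suc r) + fib_binom (b - 1) r"
proof (cases "r < b")
  case True
  then obtain m where "b - r = Suc m"
    by (metis Suc_diff_Suc)
  then have "Suc b - Suc r = Suc m" "b - Suc r = m" "b - 1 - r = m"
    by auto
  then show ?thesis
    by (simp add: fib_binom_def)
next
  case False
  with assms show ?thesis
    by (simp add: fib_binom_def binomial_eq_0)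
qed

text \<open>Summing the recurrence telescopes: $z \sum_c Q_c = Q_{b'} - Q_b$.\<close>

lemma sum_fib_binom:
  assumes "b \<le> b'"
  shows "(\<Sum>c = b - 1..<b' - 1. fib_binom c r) = fib_binom b' (Suc r) - fib_binom b (Suc r)"
  using assms
proof (induction b' rule: dec_induct)
  case (step m)
  show ?case
  proof (cases "m = 0")
    case True
    then show ?thesis
      using step by (simp add: fib_binom_def)
  next
    case False
    then have "{b - 1..<Suc m - 1} = insert (m - 1) {b - 1..<m - 1}"
      using step by auto
    then show ?thesis
      using step fib_binom_recurrence[of m r] False by simp
  qed
qed simp

section \<open>Flagged tableaux of arbitrary shape\<close>

text \<open>Row \<open>i\<close> of the shape has length \<open>\<nu> (i - 1)\<close>: cells are indexed from 1, whereas shape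
  vectors are indexed from 0 so that they match the row indices of a matrix.\<close>

definition cells :: "nat \<Rightarrow> (nat \<Rightarrow> nat) \<Rightarrow> (nat \<times> nat) set" where
  "cells t \<nu> = {(i, j). 1 \<le> i \<and> i \<le> t \<and> 1 \<le> j \<and> j \<le> \<nu> (i - 1)}"

text \<open>The condition on the first row is what a nonzero Okounkov--Olshanski term amounts to for staircase
  shapes. The shapes have at most \<open>t\<close>
  rows, as column strictness requires for entries in \<open>{1..t}\<close>.\<close>

definition flagged_tableaux :: "nat \<Rightarrow> (nat \<Rightarrow> nat) \<Rightarrow> (nat \<times> nat \<Rightarrow> nat) set" where
  "flagged_tableaux t \<nu> = {T \<in> cells t \<nu> \<rightarrow>\<^sub>E {1..t}.
     (\<forall>i j j'. i < t \<longrightarrow> 1 \<le> j \<longrightarrow> j < j' \<longrightarrow> j' \<le> \<nu> i \<longrightarrow> T (Suc i, j) \<le> T (Suc i, j')) \<and>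
     (\<forall>i i' j. i < i' \<longrightarrow> i' < t \<longrightarrow> 1 \<le> j \<longrightarrow> j \<le> \<nu> i \<longrightarrow> j \<le> \<nu> i' \<longrightarrow>
        T (Suc i, j) < T (Suc i', j)) \<and>
     (\<forall>j. 0 < t \<longrightarrow> 1 \<le> j \<longrightarrow> j \<le> \<nu> 0 \<longrightarrow> j \<le> T (1, j))}"

text \<open>A first row longer than \<open>t\<close> admits no flagged tableau: its last entry would exceed \<open>t\<close>.\<close>

definition flag_shape :: "nat \<Rightarrow> (nat \<Rightarrow> nat) \<Rightarrow> bool" where
  "flag_shape t \<nu> \<longleftrightarrow> (\<forall>i i'. i \<le> i' \<longrightarrow> i' < t \<longrightarrow> \<nu> i' \<le> \<nu> i) \<and> (0 < t \<longrightarrow> \<nu> 0 \<le> t)"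

lemma Suc_mem_cells [simp]: "(Suc i, j) \<in> cells t \<nu> \<longleftrightarrow> i < t \<and> 1 \<le> j \<and> j \<le> \<nu> i"
  by (auto simp: cells_def)

lemma cells_cases:
  assumes "u \<in> cells t \<nu>"
  obtains i j where "u = (Suc i, j)" "i < t" "1 \<le> j" "j \<le> \<nu> i"
  using assms by (cases u; cases "fst u") (auto simp: cells_def)

lemma finite_cells: "finite (cells t \<nu>)"
proof (rule finite_subset)
  show "cells t \<nu> \<subseteq> (\<Union>i\<in>{1..t}. {i} \<times> {1..\<nu> (i - 1)})"
    by (auto simp: cells_def)
qed auto

lemma finite_flagged_tableaux: "finite (flagged_tableaux t \<nu>)"
  by (rule finite_subset[of _ "cells t \<nu> \<rightarrow>\<^sub>E {1..t}"])
    (auto simp: flagged_tableaux_def intro!: finite_PiE finite_cells)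

lemma flagged_tableaux_range:
  assumes "T \<in> flagged_tableaux t \<nu>" "i < t" "1 \<le> j" "j \<le> \<nu> i"
  shows "1 \<le> T (Suc i, j)" "T (Suc i, j) \<le> t"
proof -
  have "T (Suc i, j) \<in> {1..t}"
    using assms unfolding flagged_tableaux_def by (intro PiE_mem[of T "cells t \<nu>"]) auto
  then show "1 \<le> T (Suc i, j)" "T (Suc i, j) \<le> t"
    by auto
qed

lemma flagged_tableaux_undefined:
  "T \<in> flagged_tableaux t \<nu> \<Longrightarrow> u \<notin> cells t \<nu> \<Longrightarrow> T u = undefined"
  unfolding flagged_tableaux_def by (elim CollectE conjE, rule PiE_arb)

lemma flagged_tableaux_entry_ge_row:
  assumes "T \<in> flagged_tableaux t \<nu>" "flag_shape t \<nu>" "i < t" "1 \<le> j" "j \<le> \<nu> i"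
  shows "Suc i \<le> T (Suc i, j)"
  using assms(3-5)
proof (induction i)
  case 0
  then show ?case
    using flagged_tableaux_range(1)[OF assms(1)] by simp
next
  case (Suc i)
  have "\<nu> (Suc i) \<le> \<nu> i"
    using assms(2) Suc.prems(1) by (simp add: flag_shape_def)
  then have "j \<le> \<nu> i"
    using Suc.prems by simp
  moreover from this have "T (Suc i, j) < T (Suc (Suc i), j)"
    using assms(1) Suc.prems by (simp add: flagged_tableaux_def)
  ultimately show ?case
    using Suc by simp
qed

lemma down_closed_initial_segment:
  assumes "\<And>j j'. 1 \<le> j \<Longrightarrow> j \<le> j' \<Longrightarrow> j' \<le> m \<Longrightarrow> P j' \<Longrightarrow> P j"
  shows "\<exists>k\<le>m. \<forall>j. 1 \<le> j \<longrightarrow> j \<le> m \<longrightarrow> (P j \<longleftrightarrow> j \<le> (k :: nat))"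
  using assms
proof (induction m)
  case (Suc m)
  show ?case
  proof (cases "P (Suc m)")
    case True
    then show ?thesis
      using Suc.prems by (intro exI[of _ "Suc m"]) auto
  next
    case False
    obtain k where "k \<le> m" "\<forall>j. 1 \<le> j \<longrightarrow> j \<le> m \<longrightarrow> (P j \<longleftrightarrow> j \<le> k)"
      using Suc by (metis le_SucI)
    with False show ?thesis
      by (intro exI[of _ k]) (auto simp: le_Suc_eq)
  qed
qed simp

text \<open>The shapes that the entries at most \<open>t\<close> of a tableau of shape \<open>\<nu>\<close> with entries at most
  \<open>t + 1\<close> can occupy. They interlace \<open>\<nu>\<close> because the entries \<open>t + 1\<close> form a horizontal
  strip. For \<open>i = 0\<close> the bound \<open>t + i\<close> is the flag condition, and for \<open>i > 0\<close> it holds for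
  every flag shape. It is the point at which the truncated difference \<open>t + i - k\<close> reaches 0, so that the
  sum over \<open>\<kappa> i\<close> telescopes without a boundary case.\<close>

definition subshapes :: "nat \<Rightarrow> (nat \<Rightarrow> nat) \<Rightarrow> (nat \<Rightarrow> nat) set" where
  "subshapes t \<nu> = PiE {..<t} (\<lambda>i. {\<nu> (Suc i)..min (\<nu> i) (t + i)})"

lemma subshapesD:
  assumes "\<kappa> \<in> subshapes t \<nu>" "i < t"
  shows "\<nu> (Suc i) \<le> \<kappa> i" "\<kappa> i \<le> \<nu> i" "\<kappa> i \<le> t + i"
  using assms by (auto simp: subshapes_def PiE_def Pi_def)

lemma flag_shape_subshape:
  assumes "flag_shape (Suc t) \<nu>" "\<kappa> \<in> subshapes t \<nu>"
  shows "flag_shape t \<kappa>"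
proof -
  have "\<kappa> i' \<le> \<kappa> i" if "i < i'" "i' < t" for i i'
  proof -
    have "\<kappa> i' \<le> \<nu> i'" "\<nu> (Suc i) \<le> \<kappa> i"
      using subshapesD[OF assms(2)] that by auto
    moreover have "\<nu> i' \<le> \<nu> (Suc i)"
      using assms(1) that by (simp add: flag_shape_def)
    ultimately show ?thesis by simp
  qed
  moreover have "\<kappa> 0 \<le> t" if "0 < t"
    using subshapesD(3)[OF assms(2) that] by simp
  ultimately show ?thesis
    unfolding flag_shape_def by (metis le_eq_less_or_eq)
qed

text \<open>The fibre over \<open>\<kappa>\<close> of the map that records the shape occupied by the entries at most \<open>t\<close>.
  By column strictness row \<open>t + 1\<close> of \<open>\<nu>\<close> contains only \<open>t + 1\<close>, so the condition
  concerns the rows above it.\<close>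

definition tableaux_over :: "nat \<Rightarrow> (nat \<Rightarrow> nat) \<Rightarrow> (nat \<Rightarrow> nat) \<Rightarrow> (nat \<times> nat \<Rightarrow> nat) set" where
  "tableaux_over t \<nu> \<kappa> = {T \<in> flagged_tableaux (Suc t) \<nu>.
     \<forall>i j. i < t \<longrightarrow> 1 \<le> j \<longrightarrow> j \<le> \<nu> i \<longrightarrow> (T (Suc i, j) \<le> t \<longleftrightarrow> j \<le> \<kappa> i)}"

lemma flagged_tableaux_split:
  assumes shape: "flag_shape (Suc t) \<nu>"
  shows "flagged_tableaux (Suc t) \<nu> = (\<Union>\<kappa>\<in>subshapes t \<nu>. tableaux_over t \<nu> \<kappa>)"
proof (intro equalityI subsetI)
  fix T
  assume T: "T \<in> flagged_tableaux (Suc t) \<nu>"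
  have "\<exists>k\<le>\<nu> i. \<forall>j. 1 \<le> j \<longrightarrow> j \<le> \<nu> i \<longrightarrow> (T (Suc i, j) \<le> t \<longleftrightarrow> j \<le> k)" if "i < t" for i
  proof (rule down_closed_initial_segment)
    fix j j'
    assume j: "1 \<le> j" "j \<le> j'" "j' \<le> \<nu> i" "T (Suc i, j') \<le> t"
    have "T (Suc i, j) \<le> T (Suc i, j')"
      using T j that by (cases "j = j'") (auto simp: flagged_tableaux_def)
    with j show "T (Suc i, j) \<le> t" by simp
  qed
  then obtain k where k: "\<And>i. i < t \<Longrightarrow> k i \<le> \<nu> i"
    "\<And>i j. i < t \<Longrightarrow> 1 \<le> j \<Longrightarrow> j \<le> \<nu> i \<Longrightarrow> T (Suc i, j) \<le> t \<longleftrightarrow> j \<le> k i"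
    by metis
  define \<kappa> where "\<kappa> = restrict k {..<t}"
  have lower: "\<nu> (Suc i) \<le> k i" if i: "i < t" for i
  proof (cases "\<nu> (Suc i) = 0")
    case False
    have le: "\<nu> (Suc i) \<le> \<nu> i"
      using shape i by (simp add: flag_shape_def)
    then have "T (Suc i, \<nu> (Suc i)) < T (Suc (Suc i), \<nu> (Suc i))"
      using T i False by (simp add: flagged_tableaux_def)
    also have "\<dots> \<le> Suc t"
      by (rule flagged_tableaux_range(2)[OF T]) (use i False in auto)
    finally show ?thesis
      using k(2)[OF i, of "\<nu> (Suc i)"] le False by simp
  qed simp
  have upper: "k i \<le> t + i" if i: "i < t" for i
  proof (cases i)
    case 0
    show ?thesis
    proof (cases "k 0 = 0")
      case False
      have "k 0 \<le> T (1, k 0)"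
        using T k(1)[of 0] i 0 False by (simp add: flagged_tableaux_def)
      also have "\<dots> \<le> t"
        using k(1)[of 0] k(2)[of 0 "k 0"] i 0 False by simp
      finally show ?thesis using 0 by simp
    qed (simp add: 0)
  next
    case (Suc i')
    have "k i \<le> \<nu> 0"
      using k(1)[OF i] shape i by (auto simp: flag_shape_def intro: order_trans)
    also have "\<nu> 0 \<le> Suc t"
      using shape by (simp add: flag_shape_def)
    finally show ?thesis using Suc by simp
  qed
  have "\<kappa> \<in> subshapes t \<nu>"
    using k(1) lower upper by (auto simp: \<kappa>_def subshapes_def)
  moreover have "T \<in> tableaux_over t \<nu> \<kappa>"
    using T k(2) by (auto simp: \<kappa>_def tableaux_over_def)
  ultimately show "T \<in> (\<Union>\<kappa>\<in>subshapes t \<nu>. tableaux_over t \<nu> \<kappa>)" by blast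
qed (auto simp: tableaux_over_def)

lemma tableaux_over_disjoint:
  assumes "\<kappa> \<in> subshapes t \<nu>" "\<kappa>' \<in> subshapes t \<nu>" "T \<in> tableaux_over t \<nu> \<kappa>" "T \<in> tableaux_over t \<nu> \<kappa>'"
  shows "\<kappa> = \<kappa>'"
proof (rule PiE_ext)
  show "\<kappa> \<in> PiE {..<t} (\<lambda>i. {\<nu> (Suc i)..min (\<nu> i) (t + i)})"
    "\<kappa>' \<in> PiE {..<t} (\<lambda>i. {\<nu> (Suc i)..min (\<nu> i) (t + i)})"
    using assms by (auto simp: subshapes_def)
  fix i
  assume "i \<in> {..<t}"
  then have i: "i < t" by simp
  have "j \<le> \<kappa> i \<longleftrightarrow> j \<le> \<kappa>' i" if "1 \<le> j" "j \<le> \<nu> i" for j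
    using assms(3,4) i that by (auto simp: tableaux_over_def)
  moreover have "\<kappa> i \<le> \<nu> i" "\<kappa>' i \<le> \<nu> i"
    using subshapesD(2) assms(1,2) i by auto
  ultimately show "\<kappa> i = \<kappa>' i"
    by (metis One_nat_def Suc_leI le_antisym le_refl not_gr_zero zero_le)
qed

text \<open>A tableau in the fibre is recovered from its entries at most \<open>t\<close> by filling the rest with
  \<open>t + 1\<close>. Interlacing of the two shapes is what makes the filled tableau column strict.\<close>

lemma bij_betw_tableaux_over:
  assumes shape: "flag_shape (Suc t) \<nu>" and \<kappa>: "\<kappa> \<in> subshapes t \<nu>"
  shows "bij_betw (\<lambda>T. restrict T (cells t \<kappa>)) (tableaux_over t \<nu> \<kappa>) (flagged_tableaux t \<kappa>)"
proof (rule bij_betw_byWitness[where f' =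
      "\<lambda>T. \<lambda>u\<in>cells (Suc t) \<nu>. if u \<in> cells t \<kappa> then T u else Suc t"])
  have sub: "j \<le> \<nu> i" if "i < t" "j \<le> \<kappa> i" for i j
    using subshapesD(2)[OF \<kappa>] that by (meson le_trans)
  show "\<forall>T\<in>tableaux_over t \<nu> \<kappa>.
      (\<lambda>u\<in>cells (Suc t) \<nu>. if u \<in> cells t \<kappa> then restrict T (cells t \<kappa>) u else Suc t) = T"
  proof
    fix T
    assume T: "T \<in> tableaux_over t \<nu> \<kappa>"
    then have T': "T \<in> flagged_tableaux (Suc t) \<nu>"
      by (simp add: tableaux_over_def)
    have new: "T (Suc i, j) = Suc t" if ij: "i < Suc t" "1 \<le> j" "j \<le> \<nu> i" "(Suc i, j) \<notin> cells t \<kappa>" for i j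
    proof (rule antisym)
      show "T (Suc i, j) \<le> Suc t"
        using flagged_tableaux_range(2)[OF T'] ij by simp
      show "Suc t \<le> T (Suc i, j)"
      proof (cases "i < t")
        case True
        then have "\<not> T (Suc i, j) \<le> t"
          using T ij by (auto simp: tableaux_over_def)
        then show ?thesis by simp
      next
        case False
        then have "i = t"
          using ij by simp
        then show ?thesis
          using flagged_tableaux_entry_ge_row[OF T' shape] ij by simp
      qed
    qed
    have "T u = undefined" if "u \<notin> cells (Suc t) \<nu>" for u
      using T' that by (rule flagged_tableaux_undefined)
    moreover have "T u = Suc t" if "u \<in> cells (Suc t) \<nu>" "u \<notin> cells t \<kappa>" for u
      using that(1) by (rule cells_cases) (use new that(2) in blast)
    ultimately show "(\<lambda>u\<in>cells (Suc t) \<nu>. if u \<in> cells t \<kappa> then restrict T (cells t \<kappa>) u else Suc t) = T"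
      by (auto simp: fun_eq_iff restrict_def)
  qed
  show "\<forall>T\<in>flagged_tableaux t \<kappa>.
      restrict (\<lambda>u\<in>cells (Suc t) \<nu>. if u \<in> cells t \<kappa> then T u else Suc t) (cells t \<kappa>) = T"
  proof
    fix T
    assume T: "T \<in> flagged_tableaux t \<kappa>"
    then have "T u = undefined" if "u \<notin> cells t \<kappa>" for u
      using that by (rule flagged_tableaux_undefined)
    moreover have "cells t \<kappa> \<subseteq> cells (Suc t) \<nu>"
      using sub by (auto elim!: cells_cases)
    ultimately show "restrict (\<lambda>u\<in>cells (Suc t) \<nu>. if u \<in> cells t \<kappa> then T u else Suc t) (cells t \<kappa>) = T"
      by (auto simp: fun_eq_iff restrict_def)
  qed
  show "(\<lambda>T. restrict T (cells t \<kappa>)) ` tableaux_over t \<nu> \<kappa> \<subseteq> flagged_tableaux t \<kappa>"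
  proof (intro image_subsetI)
    fix T
    assume T: "T \<in> tableaux_over t \<nu> \<kappa>"
    then have T': "T \<in> flagged_tableaux (Suc t) \<nu>"
      by (simp add: tableaux_over_def)
    have "1 \<le> T (Suc i, j) \<and> T (Suc i, j) \<le> t" if "i < t" "1 \<le> j" "j \<le> \<kappa> i" for i j
      using T that sub[of i j] flagged_tableaux_range(1)[OF T', of i j] by (auto simp: tableaux_over_def)
    then have "restrict T (cells t \<kappa>) \<in> cells t \<kappa> \<rightarrow>\<^sub>E {1..t}"
      by (auto elim!: cells_cases)
    then show "restrict T (cells t \<kappa>) \<in> flagged_tableaux t \<kappa>"
      using T' sub by (auto simp: flagged_tableaux_def)
  qed
  show "(\<lambda>T. \<lambda>u\<in>cells (Suc t) \<nu>. if u \<in> cells t \<kappa> then T u else Suc t) ` flagged_tableaux t \<kappa>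
      \<subseteq> tableaux_over t \<nu> \<kappa>"
  proof (intro image_subsetI)
    fix T
    assume T: "T \<in> flagged_tableaux t \<kappa>"
    define E where "E = (\<lambda>u\<in>cells (Suc t) \<nu>. if u \<in> cells t \<kappa> then T u else Suc t)"
    have old: "E (Suc i, j) = T (Suc i, j)" if "i < t" "1 \<le> j" "j \<le> \<kappa> i" for i j
      using that sub[of i j] by (simp add: E_def)
    have new: "E (Suc i, j) = Suc t" if "i < Suc t" "1 \<le> j" "j \<le> \<nu> i" "\<not> (i < t \<and> j \<le> \<kappa> i)" for i j
      using that by (auto simp: E_def)
    have T_le: "T (Suc i, j) \<le> t" "1 \<le> T (Suc i, j)" if "i < t" "1 \<le> j" "j \<le> \<kappa> i" for i j
      using flagged_tableaux_range[OF T that] by auto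
    have E_le: "E (Suc i, j) \<in> {1..Suc t}" if "i < Suc t" "1 \<le> j" "j \<le> \<nu> i" for i j
      using old[of i j] new[of i j] T_le[of i j] that by (cases "i < t \<and> j \<le> \<kappa> i") auto
    have "E \<in> cells (Suc t) \<nu> \<rightarrow>\<^sub>E {1..Suc t}"
    proof (rule PiE_I)
      fix u
      assume "u \<in> cells (Suc t) \<nu>"
      then show "E u \<in> {1..Suc t}"
        using E_le by (auto elim!: cells_cases)
    qed (simp add: E_def)
    moreover have "E (Suc i, j) \<le> E (Suc i, j')" if "i < Suc t" "1 \<le> j" "j < j'" "j' \<le> \<nu> i" for i j j'
    proof (cases "i < t \<and> j' \<le> \<kappa> i")
      case True
      then show ?thesis
        using old[of i j] old[of i j'] T that by (auto simp: flagged_tableaux_def)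
    next
      case False
      then show ?thesis
        using new[of i j'] E_le[of i j] that by auto
    qed
    moreover have "E (Suc i, j) < E (Suc i', j)"
      if "i < i'" "i' < Suc t" "1 \<le> j" "j \<le> \<nu> i" "j \<le> \<nu> i'" for i i' j
    proof -
      have "\<nu> i' \<le> \<nu> (Suc i)"
        using shape that by (simp add: flag_shape_def)
      also have "\<dots> \<le> \<kappa> i"
        using subshapesD(1)[OF \<kappa>] that by simp
      finally have i: "i < t" "j \<le> \<kappa> i"
        using that by auto
      show ?thesis
      proof (cases "i' < t \<and> j \<le> \<kappa> i'")
        case True
        then show ?thesis
          using old[of i j] old[of i' j] T that i by (auto simp: flagged_tableaux_def)
      next
        case False
        then show ?thesis
          using new[of i' j] old[of i j] T_le[of i j] that i by auto
      qed
    qed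
    moreover have "j \<le> E (1, j)" if "1 \<le> j" "j \<le> \<nu> 0" for j
    proof (cases "0 < t \<and> j \<le> \<kappa> 0")
      case True
      then show ?thesis
        using old[of 0 j] T that by (auto simp: flagged_tableaux_def)
    next
      case False
      then show ?thesis
        using new[of 0 j] that shape by (auto simp: flag_shape_def)
    qed
    ultimately have "E \<in> flagged_tableaux (Suc t) \<nu>"
      by (auto simp: flagged_tableaux_def)
    moreover have "E (Suc i, j) \<le> t \<longleftrightarrow> j \<le> \<kappa> i" if "i < t" "1 \<le> j" "j \<le> \<nu> i" for i j
      using old[of i j] new[of i j] T_le[of i j] that by (cases "j \<le> \<kappa> i") auto
    ultimately show "(\<lambda>u\<in>cells (Suc t) \<nu>. if u \<in> cells t \<kappa> then T u else Suc t) \<in> tableaux_over t \<nu> \<kappa>"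
      unfolding E_def[symmetric] by (auto simp: tableaux_over_def)
  qed
qed

lemma card_flagged_tableaux_Suc:
  assumes "flag_shape (Suc t) \<nu>"
  shows "card (flagged_tableaux (Suc t) \<nu>) = (\<Sum>\<kappa>\<in>subshapes t \<nu>. card (flagged_tableaux t \<kappa>))"
proof -
  have "card (flagged_tableaux (Suc t) \<nu>) = (\<Sum>\<kappa>\<in>subshapes t \<nu>. card (tableaux_over t \<nu> \<kappa>))"
    unfolding flagged_tableaux_split[OF assms]
  proof (rule card_UN_disjoint)
    show "finite (subshapes t \<nu>)"
      by (auto simp: subshapes_def intro!: finite_PiE)
    show "\<forall>\<kappa>\<in>subshapes t \<nu>. finite (tableaux_over t \<nu> \<kappa>)"
      by (auto simp: tableaux_over_def finite_flagged_tableaux)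
  qed (use tableaux_over_disjoint in blast)
  also have "\<dots> = (\<Sum>\<kappa>\<in>subshapes t \<nu>. card (flagged_tableaux t \<kappa>))"
    using assms by (intro sum.cong refl bij_betw_same_card[OF bij_betw_tableaux_over])
  finally show ?thesis .
qed

text \<open>Removing the largest entry sums the count over interlacing shapes. On the determinant, a row
  difference of Fibonacci polynomials is the sum, over the admissible lengths of one row, of the same
  polynomials one size down, and multilinearity collects these sums into the sum over interlacing
  shapes.\<close>

theorem card_flagged_tableaux:
  assumes "flag_shape t \<nu>"
  shows "real (card (flagged_tableaux t \<nu>)) =
    det (mat t t (\<lambda>(i, r). fib_binom (t + i - \<nu> i) r))"
  using assms
proof (induction t arbitrary: \<nu>)
  case 0
  have "cells 0 \<nu> = {}"
    by (auto simp: cells_def)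
  then have "flagged_tableaux 0 \<nu> = {\<lambda>_. undefined}"
    by (simp add: flagged_tableaux_def)
  then show ?case by simp
next
  case (Suc t)
  have "fib_binom (Suc t + Suc i - \<nu> (Suc i)) (Suc r) - fib_binom (Suc t + i - \<nu> i) (Suc r) =
      (\<Sum>k = \<nu> (Suc i)..min (\<nu> i) (t + i). fib_binom (t + i - k) r)" if i: "i < t" for i r
  proof -
    have "\<nu> (Suc i) \<le> \<nu> i" "\<nu> (Suc i) \<le> \<nu> 0" "\<nu> 0 \<le> Suc t"
      using Suc.prems i by (auto simp: flag_shape_def)
    then have "(\<Sum>k = \<nu> (Suc i)..min (\<nu> i) (t + i). fib_binom (t + i - k) r) =
        (\<Sum>c = Suc t + i - \<nu> i - 1..<Suc t + Suc i - \<nu> (Suc i) - 1. fib_binom c r)"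
      by (intro sum.reindex_bij_witness[of _ "\<lambda>c. t + i - c" "\<lambda>k. t + i - k"]) auto
    also have "\<dots> = fib_binom (Suc t + Suc i - \<nu> (Suc i)) (Suc r) - fib_binom (Suc t + i - \<nu> i) (Suc r)"
      using \<open>\<nu> (Suc i) \<le> \<nu> i\<close> by (intro sum_fib_binom) simp
    finally show ?thesis by simp
  qed
  then have "det (mat (Suc t) (Suc t) (\<lambda>(i, r). fib_binom (Suc t + i - \<nu> i) r)) =
      det (mat t t (\<lambda>(i, r). \<Sum>k = \<nu> (Suc i)..min (\<nu> i) (t + i). fib_binom (t + i - k) r))"
    by (subst det_row_differences) (auto intro!: arg_cong[of _ _ det] eq_matI)
  also have "\<dots> = (\<Sum>\<kappa>\<in>subshapes t \<nu>. det (mat t t (\<lambda>(i, r). fib_binom (t + i - \<kappa> i) r)))"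
    unfolding subshapes_def by (rule det_sum_rows) simp
  also have "\<dots> = (\<Sum>\<kappa>\<in>subshapes t \<nu>. real (card (flagged_tableaux t \<kappa>)))"
    using Suc.IH flag_shape_subshape[OF Suc.prems] by simp
  also have "\<dots> = real (card (flagged_tableaux (Suc t) \<nu>))"
    by (simp add: card_flagged_tableaux_Suc[OF Suc.prems])
  finally show ?case by simp
qed

section \<open>The hyperbolic tangent and Genocchi numbers\<close>

text \<open>The coefficient of $x^{2m}$ in $x \tanh(x/2)$.\<close>

definition tanh_half_coeff :: "nat \<Rightarrow> real" where
  "tanh_half_coeff m = 2 * (4 ^ m - 1) * bernoulli (2 * m) / fact (2 * m)"

lemma tanh_half_coeff_genocchi:
  assumes "1 \<le> m"
  shows "tanh_half_coeff m = (-1) ^ (m - 1) * genocchi_hat m"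
proof -
  have "(-1 :: real) ^ (m - 1) * (-1) ^ (m - 1) = 1"
    by (simp flip: power_mult_distrib)
  then show ?thesis
    by (simp add: tanh_half_coeff_def genocchi_hat_def genocchi_even_def algebra_simps)
qed

text \<open>With $\beta(x) = x/(e^x-1)$ the series in question is $2\beta(2x) - 2\beta(x) + x$. Writing
  $E = e^x$, one has $\beta(x)(E-1) = x$ and $\beta(2x)(E^2-1) = 2x$, so multiplying by $(E+1)(E-1)$
  leaves $4x - 2x(E+1) + x(E^2-1) = x(E-1)^2$.\<close>

lemma bernoulli_tanh_half:
  defines "H \<equiv> Abs_fps (\<lambda>n. 2 * (2 ^ n - 1) * bernoulli n / fact n) + fps_X"
  shows "H * (fps_exp 1 + 1) = fps_X * (fps_exp 1 - 1)"
proof -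
  define B where "B = Abs_fps (\<lambda>n. bernoulli n / fact n)"
  define B2 where "B2 = Abs_fps (\<lambda>n. 2 ^ n * (bernoulli n / fact n))"
  define E where "E = fps_exp (1 :: real)"
  have B: "B * (E - 1) = fps_X"
    using bernoulli_egf by (simp add: B_def E_def)
  have E2: "E oo (fps_const 2 * fps_X) = E * E"
    by (simp add: E_def fps_exp_compose_linear flip: fps_exp_add_mult)
  have "B oo (fps_const 2 * fps_X) = B2"
    by (simp add: B_def B2_def fps_compose_linear)
  moreover have "(B * (E - 1)) oo (fps_const 2 * fps_X) = fps_X oo (fps_const 2 * fps_X)"
    by (simp add: B)
  ultimately have B2: "B2 * (E * E - 1) = 2 * fps_X"
    by (simp add: fps_compose_mult_distrib fps_compose_sub_distrib E2 numeral_fps_const)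
  have H: "H = 2 * B2 - 2 * B + fps_X"
    by (rule fps_ext) (simp add: H_def B_def B2_def numeral_fps_const algebra_simps diff_divide_distrib)
  have nz: "E - 1 \<noteq> 0"
    using B by auto
  have "H * (E + 1) * (E - 1) = 2 * (B2 * (E * E - 1)) - 2 * (B * (E - 1)) * (E + 1) + fps_X * (E * E - 1)"
    unfolding H by (simp add: algebra_simps)
  also have "\<dots> = fps_X * (E - 1) * (E - 1)"
    unfolding B B2 by (simp add: algebra_simps)
  finally show ?thesis
    using nz by (simp add: E_def)
qed

text \<open>The coefficient of $x^{2M}$ in $x \tanh(x/2) \cdot \cosh(x/2) = x \sinh(x/2)$. Only even
  coefficients of the first factor contribute, because $\cosh$ is even.\<close>

lemma tanh_half_cosh_half:
  assumes "1 \<le> M"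
  shows "(\<Sum>m\<le>M. tanh_half_coeff m / (2 ^ (2 * (M - m)) * fact (2 * (M - m)))) =
    1 / (2 ^ (2 * M - 1) * fact (2 * M - 1))"
proof -
  define H :: "real fps" where "H = Abs_fps (\<lambda>n. 2 * (2 ^ n - 1) * bernoulli n / fact n) + fps_X"
  define Ch where "Ch = fps_exp (1 / 2 :: real) + fps_exp (- 1 / 2)"
  define Sh where "Sh = fps_exp (1 / 2 :: real) - fps_exp (- 1 / 2)"
  \<comment> \<open>Multiplying numerator and denominator by $e^{-x/2}$ turns $E \pm 1$ into $2\cosh(x/2)$ and
    $2\sinh(x/2)$.\<close>
  have e: "fps_exp 1 * fps_exp (- 1 / 2 :: real) = fps_exp (1 / 2)"
    using fps_exp_add_mult[of 1 "- 1 / 2 :: real"] by simp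
  have Ch: "(fps_exp 1 + 1) * fps_exp (- 1 / 2 :: real) = Ch"
    and Sh: "(fps_exp 1 - 1) * fps_exp (- 1 / 2 :: real) = Sh"
    by (simp_all only: Ch_def Sh_def distrib_right left_diff_distrib e mult_1_left)
  have "H * Ch = H * (fps_exp 1 + 1) * fps_exp (- 1 / 2)"
    by (simp only: Ch [symmetric] mult.assoc)
  also have "H * (fps_exp 1 + 1) = fps_X * (fps_exp 1 - 1)"
    unfolding H_def by (rule bernoulli_tanh_half)
  also have "\<dots> * fps_exp (- 1 / 2) = fps_X * Sh"
    by (simp only: Sh [symmetric] mult.assoc)
  finally have "H * Ch = fps_X * Sh" .
  then have "fps_nth (H * Ch) (2 * M) = fps_nth (fps_X * Sh) (2 * M)"
    by simp
  also have "fps_nth (fps_X * Sh) (2 * M) = 2 * (1 / (2 ^ (2 * M - 1) * fact (2 * M - 1)))"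
    using assms by (simp add: Sh_def power_divide power_minus_odd field_simps)
  also have "fps_nth (H * Ch) (2 * M) = (\<Sum>i = 0..2 * M. fps_nth H i * fps_nth Ch (2 * M - i))"
    by (simp add: fps_mult_nth)
  also have "\<dots> = (\<Sum>i\<in>(*) 2 ` {..M}. fps_nth H i * fps_nth Ch (2 * M - i))"
  proof (rule sum.mono_neutral_right)
    show "\<forall>i\<in>{0..2 * M} - (*) 2 ` {..M}. fps_nth H i * fps_nth Ch (2 * M - i) = 0"
    proof
      fix i
      assume i: "i \<in> {0..2 * M} - (*) 2 ` {..M}"
      then have "odd i"
        by (auto elim!: evenE)
      with i have "odd (2 * M - i)"
        by auto
      then have "fps_nth Ch (2 * M - i) = 0"
        by (simp add: Ch_def power_divide power_minus_odd)
      then show "fps_nth H i * fps_nth Ch (2 * M - i) = 0"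
        by simp
    qed
  qed auto
  also have "\<dots> = (\<Sum>m\<le>M. fps_nth H (2 * m) * fps_nth Ch (2 * M - 2 * m))"
    by (subst sum.reindex) (auto simp: inj_on_def)
  also have "\<dots> = (\<Sum>m\<le>M. 2 * (tanh_half_coeff m / (2 ^ (2 * (M - m)) * fact (2 * (M - m)))))"
  proof (intro sum.cong refl)
    fix m
    assume "m \<in> {..M}"
    have "fps_nth H (2 * m) = tanh_half_coeff m"
      by (simp add: H_def tanh_half_coeff_def power_mult)
    moreover have "fps_nth Ch (2 * M - 2 * m) = 2 / (2 ^ (2 * (M - m)) * fact (2 * (M - m)))"
      by (simp add: Ch_def power_divide right_diff_distrib')
    ultimately show "fps_nth H (2 * m) * fps_nth Ch (2 * M - 2 * m) =
        2 * (tanh_half_coeff m / (2 ^ (2 * (M - m)) * fact (2 * (M - m))))"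
      by simp
  qed
  also have "\<dots> = 2 * (\<Sum>m\<le>M. tanh_half_coeff m / (2 ^ (2 * (M - m)) * fact (2 * (M - m))))"
    by (rule sum_distrib_left [symmetric])
  finally show ?thesis
    by (simp only: mult_cancel_left) simp
qed

section \<open>From Fibonacci polynomials to exponential series\<close>

text \<open>The coefficient of $x^{b-2l}$ in $e^{x/2}$: rows with even \<open>b\<close> contain coefficients of
  $\cosh(x/2)$, rows with odd \<open>b\<close> coefficients of $\sinh(x/2)$.\<close>

definition half_exp_coeff :: "nat \<Rightarrow> nat \<Rightarrow> real" where
  "half_exp_coeff b l = (if 2 * l \<le> b then 1 / (2 ^ (b - 2 * l) * fact (b - 2 * l)) else 0)"

text \<open>The coefficient of $s^l$ in $(s - 1/4)^r$.\<close>

definition shift_coeff :: "nat \<Rightarrow> nat \<Rightarrow> real" where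
  "shift_coeff r l = real (r choose l) * (- 1 / 4) ^ (r - l)"

lemma shift_coeff_Suc_0: "shift_coeff (Suc r) 0 = - shift_coeff r 0 / 4"
  by (simp add: shift_coeff_def)

lemma shift_coeff_Suc_Suc: "shift_coeff (Suc r) (Suc l) = shift_coeff r l - shift_coeff r (Suc l) / 4"
proof (cases "l < r")
  case True
  then have "r - l = Suc (r - Suc l)" by simp
  then show ?thesis
    by (simp add: shift_coeff_def algebra_simps)
qed (auto simp: shift_coeff_def binomial_eq_0)

text \<open>The coefficient of $s^l$ in
  $\big((1/2+\sqrt s)^{b+1} - (1/2-\sqrt s)^{b+1}\big) / (2 \sqrt s)$.\<close>

definition odd_part_coeff :: "nat \<Rightarrow> nat \<Rightarrow> real" where
  "odd_part_coeff b l = 4 ^ l * real (Suc b choose (2 * l + 1)) / 2 ^ b"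

lemma odd_part_coeff_rec_0:
  "odd_part_coeff (Suc (Suc b)) 0 = odd_part_coeff (Suc b) 0 - odd_part_coeff b 0 / 4"
  by (simp add: odd_part_coeff_def field_simps)

lemma odd_part_coeff_rec_Suc:
  "odd_part_coeff (Suc (Suc b)) (Suc l) =
     odd_part_coeff (Suc b) (Suc l) + odd_part_coeff b l - odd_part_coeff b (Suc l) / 4"
proof -
  have "(Suc (Suc (Suc b)) choose (2 * l + 3)) + (Suc b choose (2 * l + 3)) =
      2 * (Suc (Suc b) choose (2 * l + 3)) + (Suc b choose (2 * l + 1))"
    by (simp add: numeral_eq_Suc)
  then have "real (Suc (Suc (Suc b)) choose (2 * l + 3)) + real (Suc b choose (2 * l + 3)) =
      2 * real (Suc (Suc b) choose (2 * l + 3)) + real (Suc b choose (2 * l + 1))"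
    by (metis of_nat_add of_nat_mult of_nat_numeral)
  then have "real (Suc (Suc (Suc b)) choose (2 * l + 3)) =
      2 * real (Suc (Suc b) choose (2 * l + 3)) + real (Suc b choose (2 * l + 1)) -
      real (Suc b choose (2 * l + 3))"
    by simp
  moreover have "2 * Suc l + 1 = 2 * l + 3" by simp
  ultimately show ?thesis
    unfolding odd_part_coeff_def by (simp only:) (simp add: field_simps)
qed

text \<open>The numbers $\alpha, \beta = 1/2 \pm \sqrt s$ have sum $1$ and product $-z$ with $z = s - 1/4$, so Binet's
  formula gives $Q_b(s - 1/4) = (\alpha^{b+1} - \beta^{b+1})/(\alpha-\beta)$. The proof compares the two
  sides through the recurrence of the Fibonacci polynomials. The bound on \<open>b\<close> ensures that
  $Q_b$ has degree less than \<open>D\<close>.\<close>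

lemma fib_binom_shift:
  assumes "b < 2 * D"
  shows "(\<Sum>r<D. fib_binom b r * shift_coeff r l) = odd_part_coeff b l"
  using assms
proof (induction b arbitrary: D l rule: less_induct)
  case (less b)
  show ?case
  proof (cases "b \<le> 1")
    case True
    have "(\<Sum>r<D. fib_binom b r * shift_coeff r l) = (\<Sum>r\<in>{0}. fib_binom b r * shift_coeff r l)"
      using less.prems True by (intro sum.mono_neutral_right) (auto simp: fib_binom_def)
    also have "\<dots> = odd_part_coeff b l"
      using True by (cases l; cases b) (auto simp: shift_coeff_def odd_part_coeff_def)
    finally show ?thesis .
  next
    case False
    then obtain c where b: "b = Suc (Suc c)"
      by (metis One_nat_def le0 le_Suc_eq not0_implies_Suc not_less_eq_eq)
    with less.prems obtain D' where D: "D = Suc D'" "c < 2 * D'"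
      by (cases D) auto
    have "(\<Sum>r<D. fib_binom b r * shift_coeff r l) =
        shift_coeff 0 l + (\<Sum>r<D'. fib_binom b (Suc r) * shift_coeff (Suc r) l)"
      unfolding D by (subst sum.lessThan_Suc_shift) simp
    also have "\<dots> = (shift_coeff 0 l + (\<Sum>r<D'. fib_binom (Suc c) (Suc r) * shift_coeff (Suc r) l)) +
        (\<Sum>r<D'. fib_binom c r * shift_coeff (Suc r) l)"
      using fib_binom_recurrence[of "Suc c"] by (simp add: b algebra_simps sum.distrib)
    also have "shift_coeff 0 l + (\<Sum>r<D'. fib_binom (Suc c) (Suc r) * shift_coeff (Suc r) l) =
        (\<Sum>r<D. fib_binom (Suc c) r * shift_coeff r l)"
      unfolding D by (subst sum.lessThan_Suc_shift) simp
    also have "\<dots> = odd_part_coeff (Suc c) l"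
      using less.prems by (intro less.IH) (auto simp: b)
    finally have split: "(\<Sum>r<D. fib_binom b r * shift_coeff r l) =
        odd_part_coeff (Suc c) l + (\<Sum>r<D'. fib_binom c r * shift_coeff (Suc r) l)" .
    have IH: "(\<Sum>r<D'. fib_binom c r * shift_coeff r l') = odd_part_coeff c l'" for l'
      using D by (intro less.IH) (auto simp: b)
    show ?thesis
    proof (cases l)
      case 0
      have "(\<Sum>r<D'. fib_binom c r * shift_coeff (Suc r) 0) =
          - (\<Sum>r<D'. fib_binom c r * shift_coeff r 0) / 4"
        by (simp add: shift_coeff_Suc_0 sum_divide_distrib sum_negf)
      then show ?thesis
        unfolding split by (simp add: 0 IH b odd_part_coeff_rec_0)
    next
      case (Suc l')
      have "(\<Sum>r<D'. fib_binom c r * shift_coeff (Suc r) (Suc l')) =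
          (\<Sum>r<D'. fib_binom c r * shift_coeff r l') - (\<Sum>r<D'. fib_binom c r * shift_coeff r (Suc l')) / 4"
        by (simp add: shift_coeff_Suc_Suc sum_divide_distrib sum_subtractf algebra_simps)
      then show ?thesis
        unfolding split by (simp add: Suc IH b odd_part_coeff_rec_Suc)
    qed
  qed
qed

lemma odd_part_coeff_eq:
  "odd_part_coeff b l = fact (Suc b) * (1 / fact (2 * l + 1)) * half_exp_coeff b l"
proof (cases "2 * l \<le> b")
  case True
  then have "real (Suc b choose (2 * l + 1)) = fact (Suc b) / (fact (2 * l + 1) * fact (b - 2 * l))"
    by (subst binomial_fact) auto
  moreover have "(2 :: real) ^ b = 4 ^ l * 2 ^ (b - 2 * l)"
  proof -
    have "(2 :: real) ^ b = 2 ^ (2 * l) * 2 ^ (b - 2 * l)"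
      using True by (simp flip: power_add)
    then show ?thesis
      by (simp add: power_mult)
  qed
  ultimately show ?thesis
    using True by (simp add: odd_part_coeff_def half_exp_coeff_def)
next
  case False
  then have "Suc b choose (2 * l + 1) = 0"
    by (intro binomial_eq_0) simp
  with False show ?thesis
    by (simp add: odd_part_coeff_def half_exp_coeff_def del: binomial_Suc_Suc)
qed

text \<open>Substituting $z = s - 1/4$ is a unitriangular change of basis of the polynomials of degree less than
  the size of the matrix. In the new basis the coefficients are single binomial coefficients, whose
  factorials split off from rows and columns.\<close>

lemma row_det_fib_binom:
  assumes "\<And>b. b \<in> set bs \<Longrightarrow> b < 2 * length bs"
  shows "row_det fib_binom bs =
    (\<Prod>i<length bs. fact (Suc (bs ! i)) / fact (2 * i + 1)) * row_det half_exp_coeff bs"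
proof -
  let ?d = "length bs"
  have "row_det fib_binom bs =
      det (mat ?d ?d (\<lambda>(i, r). fib_binom (bs ! i) r)) * det (mat ?d ?d (\<lambda>(i, j). shift_coeff i j))"
    by (subst (2) det_unit_lower_triangular) (auto simp: row_det_def shift_coeff_def)
  also have "\<dots> = det (mat ?d ?d (\<lambda>(i, l). \<Sum>r<?d. fib_binom (bs ! i) r * shift_coeff r l))"
    by (rule det_mult_mat [symmetric])
  also have "\<dots> = det (mat ?d ?d (\<lambda>(i, l).
      fact (Suc (bs ! i)) * (1 / fact (2 * l + 1)) * half_exp_coeff (bs ! i) l))"
    using assms by (intro arg_cong[of _ _ det] eq_matI) (auto simp: fib_binom_shift odd_part_coeff_eq)
  also have "\<dots> = (\<Prod>i<?d. fact (Suc (bs ! i))) * (\<Prod>l<?d. 1 / fact (2 * l + 1)) * row_det half_exp_coeff bs"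
    unfolding row_det_def by (rule det_scale_rows_cols)
  finally show ?thesis
    by (simp add: prod_dividef)
qed

section \<open>Elimination of the hyperbolic cosine\<close>

text \<open>Each \<open>h i\<close> is moved to the very front, past \<open>i\<close> rows \<open>h\<close> and \<open>n + i\<close> rows \<open>e\<close>;
  the sign of this move is $(-1)^n$ for every \<open>i\<close>. Placing the rows \<open>h\<close> in reversed order
  is what makes the sign independent of \<open>i\<close>.\<close>

lemma row_det_interleaved:
  fixes f :: "'b \<Rightarrow> nat \<Rightarrow> 'a :: comm_ring_1"
  shows "row_det f (map e [0..<n] @ concat (map (\<lambda>i. [h i, e (n + i)]) [0..<k]) @ ys) =
    (-1) ^ (n * k) * row_det f (rev (map h [0..<k]) @ map e [0..<n + k] @ ys)"
proof (induction k arbitrary: ys)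
  case (Suc k)
  let ?xs = "rev (map h [0..<k]) @ map e [0..<n + k]"
  have "row_det f (map e [0..<n] @ concat (map (\<lambda>i. [h i, e (n + i)]) [0..<Suc k]) @ ys) =
      (-1) ^ (n * k) * row_det f (?xs @ h k # e (n + k) # ys)"
    using Suc.IH[of "h k # e (n + k) # ys"] by simp
  also have "row_det f (?xs @ h k # e (n + k) # ys) =
      (-1) ^ length ?xs * row_det f (h k # ?xs @ e (n + k) # ys)"
    by (rule row_det_move_to_front)
  also have "(-1 :: 'a) ^ length ?xs = (-1) ^ n"
    by (simp add: power_add mult.commute flip: power_mult_distrib)
  finally show ?case
    by (simp add: power_add flip: mult.assoc)
qed simp

text \<open>After the reordering, row \<open>i \<ge> k\<close> agrees with row \<open>i\<close> of the unitriangular Toeplitz matrix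
  of $\cosh(x/2)$, and the first \<open>k\<close> rows are windows of $\sinh(x/2) = \tanh(x/2) \cosh(x/2)$. Dividing
  by the Toeplitz matrix leaves unit vectors in the rows \<open>i \<ge> k\<close> and coefficients of
  $\tanh(x/2)$ in the others, so only a \<open>k \<times> k\<close> minor remains.\<close>

lemma row_det_half_exp:
  assumes "1 \<le> k"
  shows "row_det half_exp_coeff (rev (map (\<lambda>i. 2 * (n + k + i) - 1) [0..<k]) @ map (\<lambda>i. 2 * (k + i)) [0..<n + k - 1]) =
    det (mat k k (\<lambda>(i, j). tanh_half_coeff (n + 1 + i + j)))" (is "row_det _ ?bs = _")
proof -
  define d where "d = n + 2 * k - 1"
  have len: "length ?bs = d"
    using assms by (simp add: d_def)
  have kd: "k \<le> d" "d - k = n + k - 1"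
    using assms by (auto simp: d_def)
  have hi: "?bs ! i = 2 * (d - i) - 1" if "i < k" for i
    using that by (simp add: nth_append rev_nth d_def)
  have lo: "?bs ! i = 2 * i" if "k \<le> i" "i < d" for i
    using that kd by (simp add: nth_append)
  \<comment> \<open>From column \<open>d - i\<close> on the truncated difference is 0, and these entries vanish because
    $x \tanh(x/2)$ has no constant term.\<close>
  define Z where "Z i r = (if i < k then tanh_half_coeff (d - i - r) else if r = i then 1 else 0)" for i r
  have prod: "half_exp_coeff (?bs ! i) l = (\<Sum>r<d. Z i r * half_exp_coeff (2 * r) l)"
    if i: "i < d" and l: "l < d" for i l
  proof (cases "i < k")
    case True
    define b where "b = d - i"
    have b: "b \<le> d" "1 \<le> b"
      using i by (auto simp: b_def)
    have t0: "tanh_half_coeff 0 = 0"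
      by (simp add: tanh_half_coeff_def)
    have "(\<Sum>r<d. Z i r * half_exp_coeff (2 * r) l) = (\<Sum>r<d. tanh_half_coeff (b - r) * half_exp_coeff (2 * r) l)"
      using True by (simp add: Z_def b_def)
    also have "\<dots> = half_exp_coeff (2 * b - 1) l"
    proof (cases "l < b")
      case True
      have "(\<Sum>r<d. tanh_half_coeff (b - r) * half_exp_coeff (2 * r) l) =
          (\<Sum>r = l..<b. tanh_half_coeff (b - r) * half_exp_coeff (2 * r) l)"
        using b t0 by (intro sum.mono_neutral_right) (auto simp: half_exp_coeff_def not_less)
      also have "\<dots> = (\<Sum>r = l..b. tanh_half_coeff (b - r) * half_exp_coeff (2 * r) l)"
        using True t0 by (intro sum.mono_neutral_left) (auto simp: not_less)
      also have "\<dots> = (\<Sum>m\<le>b - l. tanh_half_coeff m / (2 ^ (2 * (b - l - m)) * fact (2 * (b - l - m))))"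
        using True by (intro sum.reindex_bij_witness[of _ "\<lambda>m. b - m" "\<lambda>r. b - r"])
          (auto simp: half_exp_coeff_def right_diff_distrib')
      also have "\<dots> = 1 / (2 ^ (2 * (b - l) - 1) * fact (2 * (b - l) - 1))"
        using True by (intro tanh_half_cosh_half) simp
      also have "\<dots> = half_exp_coeff (2 * b - 1) l"
      proof -
        have "2 * (b - l) - 1 = 2 * b - 1 - 2 * l" "2 * l \<le> 2 * b - 1"
          using True by auto
        then show ?thesis
          by (simp add: half_exp_coeff_def)
      qed
      finally show ?thesis .
    next
      case False
      then have "tanh_half_coeff (b - r) * half_exp_coeff (2 * r) l = 0" for r
        using t0 by (cases "r < b") (auto simp: half_exp_coeff_def)
      then have "(\<Sum>r<d. tanh_half_coeff (b - r) * half_exp_coeff (2 * r) l) = 0"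
        by (intro sum.neutral) blast
      moreover have "\<not> 2 * l \<le> 2 * b - 1"
        using False b by linarith
      ultimately show ?thesis
        by (simp add: half_exp_coeff_def)
    qed
    finally show ?thesis
      using hi[OF True] by (simp add: b_def)
  next
    case False
    then have "(\<Sum>r<d. Z i r * half_exp_coeff (2 * r) l) = (\<Sum>r\<in>{i}. Z i r * half_exp_coeff (2 * r) l)"
      using i by (intro sum.mono_neutral_right) (auto simp: Z_def)
    then show ?thesis
      using lo[of i] False i by (simp add: Z_def)
  qed
  have "row_det half_exp_coeff ?bs = det (mat d d (\<lambda>(i, l). \<Sum>r<d. Z i r * half_exp_coeff (2 * r) l))"
    unfolding row_det_def len using prod by (intro arg_cong[of _ _ det] eq_matI) auto
  also have "\<dots> = det (mat d d (\<lambda>(i, j). Z i j))"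
    unfolding det_mult_mat by (subst (2) det_unit_lower_triangular) (auto simp: half_exp_coeff_def)
  also have "mat d d (\<lambda>(i, j). Z i j) =
      four_block_mat (mat k k (\<lambda>(i, j). Z i j)) (mat k (d - k) (\<lambda>(i, j). Z i (k + j)))
        (0\<^sub>m (d - k) k) (1\<^sub>m (d - k))"
    using kd by (intro eq_matI) (auto simp: Z_def)
  also have "det \<dots> = det (mat k k (\<lambda>(i, j). Z i j))"
    by (subst det_four_block_mat_lower_left_zero[of _ k _ "d - k"]) auto
  also have "mat k k (\<lambda>(i, j). Z i j) =
      mat k k (\<lambda>(i, j). tanh_half_coeff (n + 1 + (k - 1 - i) + (k - 1 - j)))"
    by (intro eq_matI) (auto simp: Z_def d_def intro!: arg_cong[of _ _ tanh_half_coeff])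
  also have "det \<dots> = det (mat k k (\<lambda>(i, j). tanh_half_coeff (n + 1 + i + j)))"
    by (rule det_reverse_rows_cols)
  finally show ?thesis .
qed

text \<open>The signs $(-1)^{n+i+j}$ that distinguish $\tanh$ from $\tan$ factor over rows and columns; apart from
  $(-1)^n$ per row they cancel in pairs.\<close>

lemma det_tanh_half_coeff:
  "det (mat k k (\<lambda>(i, j). tanh_half_coeff (n + 1 + i + j))) = (-1) ^ (n * k) * det (genocchi_matrix n k)"
proof -
  have "mat k k (\<lambda>(i, j). tanh_half_coeff (n + 1 + i + j)) =
      mat k k (\<lambda>(i, j). (-1) ^ (n + i) * (-1) ^ j * genocchi_hat (n + (i + 1) + (j + 1) - 1))"
    by (intro eq_matI) (auto simp: tanh_half_coeff_genocchi power_add)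
  then have "det (mat k k (\<lambda>(i, j). tanh_half_coeff (n + 1 + i + j))) =
      ((\<Prod>i<k. (-1) ^ (n + i)) * (\<Prod>j<k. (-1) ^ j)) * det (genocchi_matrix n k)"
    unfolding genocchi_matrix_def by (simp only: det_scale_rows_cols)
  also have "(\<Prod>i<k. (-1 :: real) ^ (n + i)) * (\<Prod>j<k. (-1) ^ j) = (\<Prod>i<k. (-1) ^ n)"
    by (simp add: power_add mult.assoc flip: prod.distrib power_mult_distrib)
  also have "\<dots> = (-1) ^ (n * k)"
    by (simp add: power_mult)
  finally show ?thesis .
qed

section \<open>Staircases\<close>

lemma diagram_staircase:
  assumes "n \<le> Suc d"
  shows "diagram (staircase n) = cells d (\<lambda>i. n - Suc i)"
  using assms by (auto simp: diagram_def part_staircase cells_def)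

text \<open>For \<open>\<lambda> = staircase N\<close> the part with index \<open>d + 1 - T(u)\<close> is \<open>T(u)\<close> itself, so a term vanishes
  iff some entry equals its content. In the first row, weak increase together with
  \<open>T(1, j) \<noteq> j - 1\<close> pushes the entries up to \<open>T(1, j) \<ge> j\<close> one column after the other;
  conversely this bound passes down the columns and keeps every entry above its content.\<close>

lemma OOT_staircase:
  assumes "n \<le> N" "1 \<le> N"
  shows "OOT (staircase N) (staircase n) = card (flagged_tableaux (N - 1) (\<lambda>i. n - Suc i))"
proof -
  let ?d = "N - 1" and ?D = "diagram (staircase n)"
  have D: "?D = cells ?d (\<lambda>i. n - Suc i)"
    using assms by (intro diagram_staircase) simp
  have mem: "(i, j) \<in> ?D \<longleftrightarrow> 1 \<le> i \<and> 1 \<le> j \<and> i + j \<le> n" for i j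
    by (auto simp: diagram_def part_staircase)
  have nonzero: "oo_term (staircase N) (staircase n) T \<noteq> 0 \<longleftrightarrow> (\<forall>j. (1, j) \<in> ?D \<longrightarrow> j \<le> T (1, j))"
    if T: "T \<in> ssyt (staircase n) ?d" for T
  proof -
    have range: "T u \<in> {1..?d}" if "u \<in> ?D" for u
      using T that by (auto simp: ssyt_def)
    have row: "T (i, j) \<le> T (i, j')" if "(i, j) \<in> ?D" "(i, j') \<in> ?D" "j < j'" for i j j'
      using T that unfolding ssyt_def by blast
    have col: "T (i, j) < T (i', j)" if "(i, j) \<in> ?D" "(i', j) \<in> ?D" "i < i'" for i i' j
      using T that unfolding ssyt_def by blast
    have part: "part (staircase N) (length (staircase N) + 1 - T u) = T u" if "u \<in> ?D" for u
      using range[OF that] by (auto simp: part_staircase length_staircase)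
    have "oo_term (staircase N) (staircase n) T \<noteq> 0 \<longleftrightarrow>
        (\<forall>u\<in>?D. int (part (staircase N) (length (staircase N) + 1 - T u)) - cell_content u \<noteq> 0)"
      unfolding oo_term_def by (simp add: finite_diagram)
    also have "\<dots> \<longleftrightarrow> (\<forall>i j. (i, j) \<in> ?D \<longrightarrow> T (i, j) + i \<noteq> j)"
    proof -
      have "int t - (int j - int i) \<noteq> 0 \<longleftrightarrow> t + i \<noteq> j" for t i j :: nat
        by linarith
      then show ?thesis
        using part by (auto simp: cell_content_def Ball_def)
    qed
    also have "\<dots> \<longleftrightarrow> (\<forall>j. (1, j) \<in> ?D \<longrightarrow> j \<le> T (1, j))"
    proof (intro iffI allI impI notI)
      fix j
      assume avoid: "\<forall>i j. (i, j) \<in> ?D \<longrightarrow> T (i, j) + i \<noteq> j" and "(1, j) \<in> ?D"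
      then show "j \<le> T (1, j)"
      proof (induction j)
        case (Suc j)
        show ?case
        proof (cases "j = 0")
          case True
          then show ?thesis
            using range[OF Suc.prems(2)] by simp
        next
          case False
          then have "(1, j) \<in> ?D"
            using Suc.prems(2) by (simp add: mem)
          then have "j \<le> T (1, j)" "T (1, j) \<le> T (1, Suc j)"
            using Suc.IH[OF avoid] row Suc.prems(2) by auto
          moreover have "T (1, Suc j) + 1 \<noteq> Suc j"
            using avoid Suc.prems(2) by blast
          ultimately show ?thesis by simp
        qed
      qed simp
    next
      fix i j
      assume flag: "\<forall>j. (1, j) \<in> ?D \<longrightarrow> j \<le> T (1, j)" and ij: "(i, j) \<in> ?D" and eq: "T (i, j) + i = j"
      have one: "(1, j) \<in> ?D"
        using ij by (simp add: mem)
      then have "T (1, j) \<le> T (i, j)"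
        using col[OF one ij] ij by (cases "i = 1") (auto simp: mem)
      moreover have "j \<le> T (1, j)" "1 \<le> i"
        using flag one ij by (auto simp: mem)
      ultimately show False
        using eq by simp
    qed
    finally show ?thesis .
  qed
  have "T \<in> flagged_tableaux ?d (\<lambda>i. n - Suc i) \<longleftrightarrow>
      T \<in> ssyt (staircase n) ?d \<and> (\<forall>j. (1, j) \<in> ?D \<longrightarrow> j \<le> T (1, j))" for T
  proof -
    have rows: "(\<forall>i j j'. (i, j) \<in> ?D \<longrightarrow> (i, j') \<in> ?D \<longrightarrow> j < j' \<longrightarrow> T (i, j) \<le> T (i, j')) \<longleftrightarrow>
        (\<forall>i j j'. i < ?d \<longrightarrow> 1 \<le> j \<longrightarrow> j < j' \<longrightarrow> j' \<le> n - Suc i \<longrightarrow> T (Suc i, j) \<le> T (Suc i, j'))"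
      unfolding D by (auto elim!: cells_cases)
    have cols: "(\<forall>i i' j. (i, j) \<in> ?D \<longrightarrow> (i', j) \<in> ?D \<longrightarrow> i < i' \<longrightarrow> T (i, j) < T (i', j)) \<longleftrightarrow>
        (\<forall>i i' j. i < i' \<longrightarrow> i' < ?d \<longrightarrow> 1 \<le> j \<longrightarrow> j \<le> n - Suc i \<longrightarrow> j \<le> n - Suc i' \<longrightarrow>
          T (Suc i, j) < T (Suc i', j))"
      unfolding D by (auto elim!: cells_cases)
    have first: "(\<forall>j. (1, j) \<in> ?D \<longrightarrow> j \<le> T (1, j)) \<longleftrightarrow>
        (\<forall>j. 0 < ?d \<longrightarrow> 1 \<le> j \<longrightarrow> j \<le> n - Suc 0 \<longrightarrow> j \<le> T (1, j))"
      unfolding D by auto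
    show ?thesis
      unfolding flagged_tableaux_def ssyt_def mem_Collect_eq rows cols first unfolding D by blast
  qed
  then have "{T \<in> ssyt (staircase n) ?d. oo_term (staircase N) (staircase n) T \<noteq> 0} =
      flagged_tableaux ?d (\<lambda>i. n - Suc i)"
    using nonzero by blast
  then show ?thesis
    by (simp add: OOT_def length_staircase)
qed

text \<open>In the determinant for the staircase the row indices \<open>b\<close> are the even numbers
  \<open>2k, 2k + 2, \<dots>\<close> in the first \<open>n\<close> rows and then consecutive numbers starting with
  \<open>2n + 2k - 1\<close>. Sorting them by parity costs the sign $(-1)^{nk}$.\<close>

lemma OOT_staircase_row_det:
  assumes "1 \<le> k"
  shows "real (OOT (staircase (n + 2 * k)) (staircase n)) =
    (-1) ^ (n * k) * row_det fib_binom
      (rev (map (\<lambda>i. 2 * (n + k + i) - 1) [0..<k]) @ map (\<lambda>i. 2 * (k + i)) [0..<n + k - 1])"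
proof -
  define h where "h = (\<lambda>i. 2 * (n + k + i) - 1)"
  define e where "e = (\<lambda>i. 2 * (k + i))"
  define b where "b i = (if i < n then 2 * (k + i) else n + 2 * k - 1 + i)" for i
  obtain m where k: "k = Suc m"
    using assms by (cases k) auto
  define d where "d = n + 2 * k - 1"
  have d: "d = Suc (n + 2 * m)"
    by (simp add: d_def k)
  have "flag_shape d (\<lambda>i. n - Suc i)"
    by (auto simp: flag_shape_def d)
  then have "real (OOT (staircase (n + 2 * k)) (staircase n)) =
      det (mat d d (\<lambda>(i, r). fib_binom (d + i - (n - Suc i)) r))"
    using assms by (subst OOT_staircase) (auto simp: card_flagged_tableaux d_def)
  also have "\<dots> = row_det fib_binom (map b [0..<d])"
    unfolding row_det_def
    by (intro arg_cong[of _ _ det] eq_matI) (auto simp: b_def d_def intro!: arg_cong2[of _ _ _ _ fib_binom])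
  also have "map b [0..<d] = map e [0..<n] @ concat (map (\<lambda>i. [h i, e (n + i)]) [0..<m]) @ [h m]"
  proof -
    have "map b [0..<n + 2 * l] = map e [0..<n] @ concat (map (\<lambda>i. [h i, e (n + i)]) [0..<l])" for l
      by (induction l) (use assms in \<open>auto simp: b_def e_def h_def\<close>)
    then show ?thesis
      by (simp add: d b_def h_def k)
  qed
  also have "row_det fib_binom \<dots> =
      (-1) ^ (n * m) * row_det fib_binom ((rev (map h [0..<m]) @ map e [0..<n + m]) @ h m # [])"
    by (subst row_det_interleaved) simp
  also have "row_det fib_binom ((rev (map h [0..<m]) @ map e [0..<n + m]) @ h m # []) =
      (-1) ^ (n + 2 * m) * row_det fib_binom (h m # (rev (map h [0..<m]) @ map e [0..<n + m]) @ [])"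
    by (subst row_det_move_to_front) (simp add: mult_2 add_ac)
  also have "(-1) ^ (n * m) * ((-1) ^ (n + 2 * m) *
        row_det fib_binom (h m # (rev (map h [0..<m]) @ map e [0..<n + m]) @ [])) =
      (-1) ^ (n * k) * row_det fib_binom (rev (map h [0..<k]) @ map e [0..<n + k - 1])"
    by (simp add: k power_add)
  finally show ?thesis
    by (simp add: h_def e_def)
qed

text \<open>The factorials attached to the even row indices cancel against those of the last columns, leaving
  those of the \<open>k\<close> odd indices; the two signs $(-1)^{nk}$, from the reordering and from passing
  to Genocchi numbers, cancel.\<close>

lemma OOT_staircase_genocchi:
  assumes "1 \<le> k"
  shows "real (OOT (staircase (n + 2 * k)) (staircase n)) =
    (\<Prod>i = 1..k. fact (2 * (n + i + k - 1)) / fact (2 * i - 1)) * det (genocchi_matrix n k)"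
proof -
  define bs where
    "bs = rev (map (\<lambda>i. 2 * (n + k + i) - 1) [0..<k]) @ map (\<lambda>i. 2 * (k + i)) [0..<n + k - 1]"
  define d where "d = n + 2 * k - 1"
  have len: "length bs = d"
    using assms by (simp add: bs_def d_def)
  have kd: "k \<le> d"
    using assms by (simp add: d_def)
  have hi: "Suc (bs ! i) = 2 * (d - i)" if "i < k" for i
    using that by (simp add: bs_def nth_append rev_nth d_def)
  have lo: "Suc (bs ! i) = 2 * i + 1" if "k \<le> i" "i < d" for i
    using that kd by (simp add: bs_def nth_append d_def)
  have "(\<Prod>i<d. fact (Suc (bs ! i)) / fact (2 * i + 1) :: real) =
      (\<Prod>i<k. fact (Suc (bs ! i)) / fact (2 * i + 1))"
    using kd by (intro prod.mono_neutral_right) (auto simp: lo not_less)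
  also have "\<dots> = (\<Prod>i<k. fact (2 * (d - i))) / (\<Prod>i<k. fact (2 * i + 1))"
    by (simp add: hi prod_dividef)
  also have "(\<Prod>i<k. fact (2 * (d - i)) :: real) = (\<Prod>i<k. fact (2 * (n + k + i)))"
    using kd by (subst prod.nat_diff_reindex [symmetric])
      (auto simp: d_def intro!: prod.cong arg_cong[of _ _ fact])
  also have "(\<Prod>i<k. fact (2 * (n + k + i))) / (\<Prod>i<k. fact (2 * i + 1)) =
      (\<Prod>i = 1..k. fact (2 * (n + i + k - 1)) / fact (2 * i - 1) :: real)"
    unfolding prod_dividef [symmetric]
    by (intro prod.reindex_bij_witness[of _ "\<lambda>i. i - 1" Suc]) (auto simp: algebra_simps)
  finally have facts: "(\<Prod>i<d. fact (Suc (bs ! i)) / fact (2 * i + 1) :: real) =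
      (\<Prod>i = 1..k. fact (2 * (n + i + k - 1)) / fact (2 * i - 1))" .
  have "real (OOT (staircase (n + 2 * k)) (staircase n)) = (-1) ^ (n * k) * row_det fib_binom bs"
    unfolding bs_def by (rule OOT_staircase_row_det[OF assms])
  also have "row_det fib_binom bs =
      (\<Prod>i<d. fact (Suc (bs ! i)) / fact (2 * i + 1)) * row_det half_exp_coeff bs"
    unfolding len [symmetric] by (rule row_det_fib_binom) (use assms in \<open>auto simp: len d_def bs_def\<close>)
  also have "row_det half_exp_coeff bs = (-1) ^ (n * k) * det (genocchi_matrix n k)"
    unfolding bs_def row_det_half_exp[OF assms] by (rule det_tanh_half_coeff)
  finally show ?thesis
    unfolding facts by (simp flip: power_mult_distrib)
qed

theorem theorem1p3:
  shows "(\<forall>(n::nat) (k::nat). 1 \<le> k \<longrightarrow>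
            real (OOT (staircase (n + 2 * k)) (staircase n)) =
              (\<Prod>i = 1..k. (fact (2 * (n + i + k - 1)) / fact (2 * i - 1) :: real)) * det (genocchi_matrix n k))
       \<and> (\<forall>n::nat. real (OOT (staircase (n + 2)) (staircase n)) = genocchi_even (n + 1))"
proof (intro conjI allI impI)
  fix n k :: nat
  assume "1 \<le> k"
  then show "real (OOT (staircase (n + 2 * k)) (staircase n)) =
      (\<Prod>i = 1..k. (fact (2 * (n + i + k - 1)) / fact (2 * i - 1) :: real)) * det (genocchi_matrix n k)"
    by (rule OOT_staircase_genocchi)
next
  fix n :: nat
  have "det (genocchi_matrix n 1) = genocchi_hat (n + 1)"
    by (subst det_single) (auto simp: genocchi_matrix_def)
  then show "real (OOT (staircase (n + 2)) (staircase n)) = genocchi_even (n + 1)"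
    using OOT_staircase_genocchi[of 1 n] by (simp add: genocchi_hat_def)
qed

end
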